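(* Let the Finsler space $(M,F)$, $\dim M=N\ge3$, be conformally automorphic to the Riemannian space $(M,S)$ with degree $H$ through the transformation $t=t(x,y)$. When $d_iF=0$, i.e. $$\frac{\partial F}{\partial x^i}+N^k{}_i(x,y)\frac{\partial F}{\partial y^k}=0,$$ and $H=\mathrm{const}$, the equation $d_i\lambda=0$, i.e. $$\frac{\partial\lambda}{\partial x^i}+N^k{}_i(x,y_1)\frac{\partial\lambda}{\partial y_1^k}+N^k{}_i(x,y_2)\frac{\partial\lambda}{\partial y_2^k}=0\qquad(y_1,y_2\in T_xM\text{ nonzero}),$$ for the scalar $$\lambda(x,y_1,y_2)=\frac{a_{mn}(x)\,t^m(x,y_1)\,t^n(x,y_2)}{S(x,t(x,y_1))\,S(x,t(x,y_2))}$$ can be solved for the coefficients $N^m{}_n=N^m{}_n(x,y)$, yielding $$N^m{}_n=-y^m_i\left(\frac{\partial t^i}{\partial x^n}+a^i{}_{kn}t^k\right).$$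
   Context: $M$ is a $C^\infty$ manifold with local coordinates $x^i$; $y^i$ are the induced coordinates of tangent vectors $y\in T_xM\setminus0$; repeated indices are summed over $1,\dots,N$; considerations are local. The Finsler metric function $F(x,y)$ is sufficiently smooth, positive, and positively homogeneous of degree 1 in $y$, with metric tensor $g_{ij}=\frac12\,\partial^2F^2/\partial y^i\partial y^j$. $S(x,y)=\sqrt{a_{ij}(x)y^iy^j}$ is a Riemannian metric function and $a^i{}_{kn}(x)$ are the Christoffel symbols of $a_{ij}$. Definition. $(M,F)$ is conformally automorphic to $(M,S)$, of degree $H=H(x)>0$, if there is a smooth family of invertible smooth transformations $y\mapsto t=t(x,y)$ of nonzero tangent vectors at $x$ into nonzero tangent vectors at the same $x$ such that: (i) $t^m(x,ky)=k^{H}t^m(x,y)$ for all $k>0$; (ii) $F(x,y)=1\iff S(x,t(x,y))=1$; (iii) $g_{mn}(x,y)=p^2\,a_{ij}(x)\,t^i_m t^j_n$, where $t^i_m=\partial t^i/\partial y^m$ and $p=p(x,y)>0$. The inverse transformation is $y^m=y^m(x,t)$ and $y^m_i=\partial y^m/\partial t^i$ (so $y^m_it^i_n=\delta^m_n$), evaluated at $t=t(x,y)$. The coefficients $N^k{}_i(x,y)$ are assumed positively homogeneous of degree 1 in $y$.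
   Formalization: The equations do not determine N uniquely (flat F=S, t=y, H=1 admits N^m_n=A^m_{kn}y^k with A skew in m,k); proved instead: the displayed N is a 1-homogeneous solution, and all solutions are it plus y^m_i A^i_{kn}(x)t^k with A skew with respect to a_ij. *)

theory Defs
  imports "HOL-Analysis.Analysis"
begin

text \<open>
  Everything is local: \<open>U\<close> is an open coordinate domain in \<open>real ^ 'n\<close>, and for \<open>x \<in> U\<close> the nonzero
  tangent vectors are the nonzero elements of \<open>real ^ 'n\<close> in the induced coordinates. Objects that
  are only defined on nonzero vectors over \<open>U\<close> are total functions whose remaining values are never
  constrained.
\<close>

text \<open>For open \<open>D\<close> in a Euclidean space this is the class \<open>C^k\<close>: all iterated directional derivatives
  up to order \<open>k\<close> exist (as Frechet derivatives) and are continuous.\<close>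

primrec Ck_on :: "nat \<Rightarrow> 'a::euclidean_space set \<Rightarrow> ('a \<Rightarrow> 'b::real_normed_vector) \<Rightarrow> bool" where
  "Ck_on 0 D f \<longleftrightarrow> continuous_on D f"
| "Ck_on (Suc k) D f \<longleftrightarrow> (\<forall>z\<in>D. f differentiable (at z)) \<and>
     (\<forall>v. Ck_on k D (\<lambda>z. frechet_derivative f (at z) v))"

definition smooth_on :: "'a::euclidean_space set \<Rightarrow> ('a \<Rightarrow> 'b::real_normed_vector) \<Rightarrow> bool" where
  "smooth_on D f \<longleftrightarrow> (\<forall>k. Ck_on k D f)"

definition partial :: "'n \<Rightarrow> (real ^ 'n \<Rightarrow> real) \<Rightarrow> real ^ 'n \<Rightarrow> real" where
  "partial i f z = frechet_derivative f (at z) (axis i 1)"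

abbreviation nonzero :: "(real ^ 'n) set" where
  "nonzero \<equiv> - {0}"

text \<open>The order of smoothness is the least one for which the metric tensor is defined and
  continuous.\<close>

definition finsler_metric_function ::
    "(real ^ 'n) set \<Rightarrow> (real ^ 'n \<Rightarrow> real ^ 'n \<Rightarrow> real) \<Rightarrow> bool" where
  "finsler_metric_function U F \<longleftrightarrow>
     Ck_on 2 (U \<times> nonzero) (\<lambda>(x, y). F x y) \<and>
     (\<forall>x\<in>U. \<forall>y\<in>nonzero. F x y > 0 \<and> (\<forall>k>0. F x (k *\<^sub>R y) = k * F x y))"

definition finsler_tensor ::
    "(real ^ 'n \<Rightarrow> real ^ 'n \<Rightarrow> real) \<Rightarrow> 'n \<Rightarrow> 'n \<Rightarrow> real ^ 'n \<Rightarrow> real ^ 'n \<Rightarrow> real" where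
  "finsler_tensor F i j x y = 1/2 * partial i (partial j (\<lambda>w. (F x w)\<^sup>2)) y"

definition riemannian_metric ::
    "(real ^ 'n) set \<Rightarrow> (real ^ 'n \<Rightarrow> real ^ 'n ^ 'n) \<Rightarrow> bool" where
  "riemannian_metric U a \<longleftrightarrow> smooth_on U a \<and>
     (\<forall>x\<in>U. transpose (a x) = a x \<and> (\<forall>v\<in>nonzero. v \<bullet> (a x *v v) > 0))"

definition riem_inner ::
    "(real ^ 'n \<Rightarrow> real ^ 'n ^ 'n) \<Rightarrow> real ^ 'n \<Rightarrow> real ^ 'n \<Rightarrow> real ^ 'n \<Rightarrow> real" where
  "riem_inner a x v w = (\<Sum>i\<in>UNIV. \<Sum>j\<in>UNIV. a x $ i $ j * v $ i * w $ j)"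

definition riem_function ::
    "(real ^ 'n \<Rightarrow> real ^ 'n ^ 'n) \<Rightarrow> real ^ 'n \<Rightarrow> real ^ 'n \<Rightarrow> real" where
  "riem_function a x v = sqrt (riem_inner a x v v)"

text \<open>\<open>christoffel a x i k n\<close> is the symbol with upper index \<open>i\<close> and lower indices \<open>k, n\<close>.\<close>

definition christoffel ::
    "(real ^ 'n \<Rightarrow> real ^ 'n ^ 'n) \<Rightarrow> real ^ 'n \<Rightarrow> 'n \<Rightarrow> 'n \<Rightarrow> 'n \<Rightarrow> real" where
  "christoffel a x i k n = 1/2 * (\<Sum>l\<in>UNIV. matrix_inv (a x) $ i $ l *
     (partial k (\<lambda>z. a z $ l $ n) x + partial n (\<lambda>z. a z $ l $ k) x
      - partial l (\<lambda>z. a z $ k $ n) x))"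

definition fibre_inv ::
    "(real ^ 'n \<Rightarrow> real ^ 'n \<Rightarrow> real ^ 'n) \<Rightarrow> real ^ 'n \<Rightarrow> real ^ 'n \<Rightarrow> real ^ 'n" where
  "fibre_inv t x = inv_into nonzero (t x)"

definition conformally_automorphic_via ::
    "(real ^ 'n) set \<Rightarrow> (real ^ 'n \<Rightarrow> real ^ 'n \<Rightarrow> real) \<Rightarrow> (real ^ 'n \<Rightarrow> real ^ 'n ^ 'n) \<Rightarrow>
     (real ^ 'n \<Rightarrow> real) \<Rightarrow> (real ^ 'n \<Rightarrow> real ^ 'n \<Rightarrow> real ^ 'n) \<Rightarrow> bool" where
  "conformally_automorphic_via U F a H t \<longleftrightarrow>
     (\<forall>x\<in>U. H x > 0) \<and>
     smooth_on (U \<times> nonzero) (\<lambda>(x, y). t x y) \<and>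
     (\<forall>x\<in>U. bij_betw (t x) nonzero nonzero \<and> smooth_on nonzero (fibre_inv t x)) \<and>
     (\<forall>x\<in>U. \<forall>y\<in>nonzero. \<forall>k>0. t x (k *\<^sub>R y) = (k powr H x) *\<^sub>R t x y) \<and>
     (\<forall>x\<in>U. \<forall>y\<in>nonzero. F x y = 1 \<longleftrightarrow> riem_function a x (t x y) = 1) \<and>
     (\<exists>p. \<forall>x\<in>U. \<forall>y\<in>nonzero. p x y > 0 \<and>
        (\<forall>m n. finsler_tensor F m n x y =
           (p x y)\<^sup>2 * (\<Sum>i\<in>UNIV. \<Sum>j\<in>UNIV. a x $ i $ j *
              partial m (\<lambda>w. t x w $ i) y * partial n (\<lambda>w. t x w $ j) y)))"

definition two_vector_scalar ::
    "(real ^ 'n \<Rightarrow> real ^ 'n ^ 'n) \<Rightarrow> (real ^ 'n \<Rightarrow> real ^ 'n \<Rightarrow> real ^ 'n) \<Rightarrow>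
     real ^ 'n \<Rightarrow> real ^ 'n \<Rightarrow> real ^ 'n \<Rightarrow> real" where
  "two_vector_scalar a t x y1 y2 = riem_inner a x (t x y1) (t x y2) /
     (riem_function a x (t x y1) * riem_function a x (t x y2))"

text \<open>The coefficient of \<open>N\<close> with upper index \<open>m\<close> and lower index \<open>n\<close> at \<open>(x, y)\<close> is
  \<open>N x y $ m $ n\<close>.\<close>

definition homogeneous_coeffs ::
    "(real ^ 'n) set \<Rightarrow> (real ^ 'n \<Rightarrow> real ^ 'n \<Rightarrow> real ^ 'n ^ 'n) \<Rightarrow> bool" where
  "homogeneous_coeffs U N \<longleftrightarrow>
     (\<forall>x\<in>U. \<forall>y\<in>nonzero. \<forall>k>0. N x (k *\<^sub>R y) = k *\<^sub>R N x y)"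

definition d_vanishes ::
    "(real ^ 'n) set \<Rightarrow> (real ^ 'n \<Rightarrow> real ^ 'n \<Rightarrow> real ^ 'n ^ 'n) \<Rightarrow>
     (real ^ 'n \<Rightarrow> real ^ 'n \<Rightarrow> real) \<Rightarrow> bool" where
  "d_vanishes U N F \<longleftrightarrow> (\<forall>x\<in>U. \<forall>y\<in>nonzero. \<forall>i.
     partial i (\<lambda>z. F z y) x + (\<Sum>k\<in>UNIV. N x y $ k $ i * partial k (F x) y) = 0)"

definition d_vanishes2 ::
    "(real ^ 'n) set \<Rightarrow> (real ^ 'n \<Rightarrow> real ^ 'n \<Rightarrow> real ^ 'n ^ 'n) \<Rightarrow>
     (real ^ 'n \<Rightarrow> real ^ 'n \<Rightarrow> real ^ 'n \<Rightarrow> real) \<Rightarrow> bool" where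
  "d_vanishes2 U N L \<longleftrightarrow> (\<forall>x\<in>U. \<forall>y1\<in>nonzero. \<forall>y2\<in>nonzero. \<forall>i.
     partial i (\<lambda>z. L z y1 y2) x
     + (\<Sum>k\<in>UNIV. N x y1 $ k $ i * partial k (\<lambda>w. L x w y2) y1)
     + (\<Sum>k\<in>UNIV. N x y2 $ k $ i * partial k (\<lambda>w. L x y1 w) y2) = 0)"

definition solution_coeffs ::
    "(real ^ 'n \<Rightarrow> real ^ 'n ^ 'n) \<Rightarrow> (real ^ 'n \<Rightarrow> real ^ 'n \<Rightarrow> real ^ 'n) \<Rightarrow>
     real ^ 'n \<Rightarrow> real ^ 'n \<Rightarrow> real ^ 'n ^ 'n" where
  "solution_coeffs a t x y = (\<chi> m n. - (\<Sum>i\<in>UNIV.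
     partial i (\<lambda>s. fibre_inv t x s $ m) (t x y) *
     (partial n (\<lambda>z. t z y $ i) x + (\<Sum>k\<in>UNIV. christoffel a x i k n * t x y $ k))))"

text \<open>The equations \<open>d_i F = 0\<close> and \<open>d_i \<lambda> = 0\<close> do not determine \<open>N\<close> uniquely: replacing the
  Christoffel symbols in \<open>solution_coeffs\<close> by \<open>christoffel a x i k n - A x i k n\<close>, where \<open>A\<close> is skew
  in its first two indices with respect to \<open>a\<close> (a metric-compatible connection with torsion),
  gives another solution. In the simplest case \<open>t x y = y\<close>, \<open>F = S\<close>, \<open>H = 1\<close> these are all the
  metric linear connections. The tensors \<open>A\<close> parametrise this freedom; \<open>A = 0\<close> is
  \<open>solution_coeffs\<close>.\<close>

definition skew_tensor ::
    "(real ^ 'n) set \<Rightarrow> (real ^ 'n \<Rightarrow> real ^ 'n ^ 'n) \<Rightarrow>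
     (real ^ 'n \<Rightarrow> 'n \<Rightarrow> 'n \<Rightarrow> 'n \<Rightarrow> real) \<Rightarrow> bool" where
  "skew_tensor U a A \<longleftrightarrow> (\<forall>x\<in>U. \<forall>j k n.
     (\<Sum>i\<in>UNIV. a x $ j $ i * A x i k n) + (\<Sum>i\<in>UNIV. a x $ k $ i * A x i j n) = 0)"

definition tensor_shift ::
    "(real ^ 'n \<Rightarrow> real ^ 'n \<Rightarrow> real ^ 'n) \<Rightarrow> (real ^ 'n \<Rightarrow> 'n \<Rightarrow> 'n \<Rightarrow> 'n \<Rightarrow> real) \<Rightarrow>
     real ^ 'n \<Rightarrow> real ^ 'n \<Rightarrow> real ^ 'n ^ 'n" where
  "tensor_shift t A x y = (\<chi> m n. \<Sum>i\<in>UNIV.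
     partial i (\<lambda>s. fibre_inv t x s $ m) (t x y) * (\<Sum>k\<in>UNIV. A x i k n * t x y $ k))"

end

theory Submission
  imports Defs
begin

text \<open>
  Since \<open>t\<close> is homogeneous of degree \<open>H\<close> and maps the indicatrix of \<open>F\<close> to that of \<open>S\<close>, the
  Riemannian length of \<open>t(x, y)\<close> is \<open>F(x, y) powr H\<close>; for constant \<open>H\<close> the equation \<open>d\<^sub>n F = 0\<close>
  therefore says that the covariant derivative \<open>B\<^sub>n(y) = d\<^sub>n t + a\<^sub>n t\<close> is orthogonal to \<open>t\<close>. As the
  Levi-Civita connection is metric, \<open>d\<^sub>n \<lambda> = 0\<close> then becomes
  \<open>\<langle>B\<^sub>n(y\<^sub>1), t(y\<^sub>2)\<rangle> + \<langle>t(y\<^sub>1), B\<^sub>n(y\<^sub>2)\<rangle> = 0\<close>. Read as a function of the vector \<open>t\<close>, a solution \<open>B\<^sub>n\<close> is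
  skew, hence linear: \<open>B\<^sub>n = A\<^sub>n t\<close> with \<open>A\<close> skew. Inverting the fibre derivative of \<open>t\<close> recovers the
  coefficients from \<open>B\<^sub>n\<close>; the value \<open>B\<^sub>n = 0\<close> gives the coefficients claimed.
\<close>

section \<open>Partial derivatives as values of Frechet derivatives\<close>

lemma partial_eq:
  assumes "(f has_derivative f') (at z)"
  shows "partial i f z = f' (axis i 1)"
  unfolding partial_def using frechet_derivative_at[OF assms] by simp

lemma sum_partial:
  fixes w :: "real ^ 'n"
  assumes "(f has_derivative f') (at z)"
  shows "(\<Sum>k\<in>UNIV. w $ k * partial k f z) = f' w"
proof -
  have lin: "linear f'" using assms by (rule has_derivative_linear)
  have "f' w = f' (\<Sum>k\<in>UNIV. w $ k *\<^sub>R axis k 1)"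
    by (simp add: basis_expansion flip: scalar_mult_eq_scaleR)
  also have "\<dots> = (\<Sum>k\<in>UNIV. w $ k * f' (axis k 1))"
    by (simp add: linear_sum[OF lin] linear_cmul[OF lin])
  finally show ?thesis by (simp add: partial_eq[OF assms])
qed

text \<open>The operator \<open>d\<^sub>n\<close> is differentiation in the single direction
  \<open>(axis n 1, w)\<close> of the total space, \<open>w\<close> being the \<open>n\<close>-th
  column of the coefficients. The chain rule can then be applied there once instead of to each
  partial derivative. \<open>total_partial_three\<close> does the same for pairs of tangent
  vectors.\<close>

lemma total_partial_two:
  fixes G :: "real ^ 'n \<Rightarrow> real ^ 'n \<Rightarrow> real"
  assumes G: "((\<lambda>(x, y). G x y) has_derivative G') (at (x, y))"
  shows "partial n (\<lambda>z. G z y) x + (\<Sum>k\<in>UNIV. w $ k * partial k (G x) y) = G' (axis n 1, w)"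
proof -
  have "((\<lambda>z. G z y) has_derivative (\<lambda>u. G' (u, 0))) (at x)"
    using has_derivative_compose[of "\<lambda>z. (z, y)" "\<lambda>u. (u, 0)" x UNIV, OF _ G]
    by (simp add: has_derivative_Pair)
  then have 1: "partial n (\<lambda>z. G z y) x = G' (axis n 1, 0)"
    by (rule partial_eq)
  have "(G x has_derivative (\<lambda>u. G' (0, u))) (at y)"
    using has_derivative_compose[of "\<lambda>z. (x, z)" "\<lambda>u. (0, u)" y UNIV, OF _ G]
    by (simp add: has_derivative_Pair)
  then have 2: "(\<Sum>k\<in>UNIV. w $ k * partial k (G x) y) = G' (0, w)"
    by (rule sum_partial)
  show ?thesis
    unfolding 1 2 by (simp flip: linear_add[OF has_derivative_linear[OF G]])
qed

lemma total_partial_three: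
  fixes G :: "real ^ 'n \<Rightarrow> real ^ 'n \<Rightarrow> real ^ 'n \<Rightarrow> real"
  assumes G: "((\<lambda>(x, y1, y2). G x y1 y2) has_derivative G') (at (x, y1, y2))"
  shows "partial n (\<lambda>z. G z y1 y2) x + (\<Sum>k\<in>UNIV. w1 $ k * partial k (\<lambda>w. G x w y2) y1)
      + (\<Sum>k\<in>UNIV. w2 $ k * partial k (G x y1) y2) = G' (axis n 1, w1, w2)"
proof -
  have "((\<lambda>z. G z y1 y2) has_derivative (\<lambda>u. G' (u, 0, 0))) (at x)"
    using has_derivative_compose[of "\<lambda>z. (z, y1, y2)" "\<lambda>u. (u, 0, 0)" x UNIV, OF _ G]
    by (simp add: has_derivative_Pair)
  then have 1: "partial n (\<lambda>z. G z y1 y2) x = G' (axis n 1, 0, 0)"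
    by (rule partial_eq)
  have "((\<lambda>w. G x w y2) has_derivative (\<lambda>u. G' (0, u, 0))) (at y1)"
    using has_derivative_compose[of "\<lambda>z. (x, z, y2)" "\<lambda>u. (0, u, 0)" y1 UNIV, OF _ G]
    by (simp add: has_derivative_Pair)
  then have 2: "(\<Sum>k\<in>UNIV. w1 $ k * partial k (\<lambda>w. G x w y2) y1) = G' (0, w1, 0)"
    by (rule sum_partial)
  have "(G x y1 has_derivative (\<lambda>u. G' (0, 0, u))) (at y2)"
    using has_derivative_compose[of "\<lambda>z. (x, y1, z)" "\<lambda>u. (0, 0, u)" y2 UNIV, OF _ G]
    by (simp add: has_derivative_Pair)
  then have 3: "(\<Sum>k\<in>UNIV. w2 $ k * partial k (G x y1) y2) = G' (0, 0, w2)"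
    by (rule sum_partial)
  show ?thesis
    unfolding 1 2 3 by (simp flip: linear_add[OF has_derivative_linear[OF G]])
qed

lemma has_derivative_component:
  fixes f :: "'a::real_normed_vector \<Rightarrow> 'b::real_normed_vector ^ 'n"
  assumes "(f has_derivative f') (at z)"
  shows "((\<lambda>z. f z $ i) has_derivative (\<lambda>v. f' v $ i)) (at z)"
  using assms by (rule bounded_linear.has_derivative[OF bounded_linear_vec_nth])

lemma smooth_on_has_derivative:
  assumes "smooth_on D f" "z \<in> D"
  shows "(f has_derivative frechet_derivative f (at z)) (at z)"
proof -
  have "Ck_on (Suc 0) D f" using assms(1) unfolding smooth_on_def by blast
  then show ?thesis using assms(2) frechet_derivative_works by auto
qed

subsection \<open>Riemannian scalar products and the Levi-Civita connection\<close>

lemma riem_inner_eq: "riem_inner a x v w = v \<bullet> (a x *v w)"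
  by (simp add: riem_inner_def inner_vec_def matrix_vector_mult_def sum_distrib_left ac_simps)

lemma riem_inner_commute:
  assumes "transpose (a x) = a x"
  shows "riem_inner a x v w = riem_inner a x w v"
  by (metis assms riem_inner_eq dot_lmul_matrix inner_commute transpose_matrix_vector)

lemma riem_inner_bilinear:
  "riem_inner a x (v + v') w = riem_inner a x v w + riem_inner a x v' w"
  "riem_inner a x w (v + v') = riem_inner a x w v + riem_inner a x w v'"
  "riem_inner a x (c *\<^sub>R v) w = c * riem_inner a x v w"
  "riem_inner a x w (c *\<^sub>R v) = c * riem_inner a x w v"
  "riem_inner a x (- v) w = - riem_inner a x v w"
  "riem_inner a x w (- v) = - riem_inner a x w v"
  "riem_inner a x 0 w = 0"
  "riem_inner a x w 0 = 0"
  by (simp_all add: riem_inner_eq inner_add_left inner_add_right matrix_vector_right_distrib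
      matrix_vector_mult_scaleR vec.neg)

text \<open>\<open>a x ** B\<close> is \<open>B\<close> with its upper index lowered, and its
  symmetric part measures the failure of \<open>B\<close> to be skew. For Christoffel symbols this
  part yields the derivative of the metric; for a skew tensor it is zero.\<close>

lemma riem_inner_matrix_sum:
  assumes "transpose (a x) = a x"
  shows "riem_inner a x (B *v v) w + riem_inner a x v (B *v w)
    = v \<bullet> ((a x ** B + transpose (a x ** B)) *v w)"
proof -
  have "v \<bullet> (transpose (a x ** B) *v w) = (B *v v) \<bullet> (a x *v w)"
    using assms by (metis dot_lmul_matrix inner_commute matrix_transpose_mul
        matrix_vector_mul_assoc transpose_matrix_vector transpose_transpose)
  then show ?thesis
    by (simp add: riem_inner_eq matrix_vector_mult_add_rdistrib inner_add_right
        flip: matrix_vector_mul_assoc)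
qed

definition christoffel_matrix ::
    "(real ^ 'n \<Rightarrow> real ^ 'n ^ 'n) \<Rightarrow> real ^ 'n \<Rightarrow> 'n \<Rightarrow> real ^ 'n ^ 'n" where
  "christoffel_matrix a x n = (\<chi> i k. christoffel a x i k n)"

lemma riemannian_metricD:
  assumes "riemannian_metric U a" "x \<in> U"
  shows "transpose (a x) = a x" "v \<noteq> 0 \<Longrightarrow> riem_inner a x v v > 0" "a x ** matrix_inv (a x) = mat 1"
proof -
  have pos: "\<And>v. v \<noteq> 0 \<Longrightarrow> riem_inner a x v v > 0" and tr: "transpose (a x) = a x"
    using assms unfolding riemannian_metric_def riem_inner_eq by auto
  have "\<forall>v. a x *v v = 0 \<longrightarrow> v = 0"
    using pos by (metis inner_zero_right less_irrefl riem_inner_eq)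
  then have "invertible (a x)"
    using matrix_left_invertible_ker invertible_left_inverse by blast
  then show "a x ** matrix_inv (a x) = mat 1"
    unfolding invertible_def matrix_inv_def by (rule someI2_ex) auto
  show "transpose (a x) = a x" "v \<noteq> 0 \<Longrightarrow> riem_inner a x v v > 0" using tr pos by auto
qed

text \<open>Lowering the index cancels the inverse metric and leaves the Christoffel symbols of the
  first kind, called \<open>c\<close> below.\<close>

lemma christoffel_lowered:
  assumes "a x ** matrix_inv (a x) = mat 1"
  shows "(\<Sum>i\<in>UNIV. a x $ j $ i * christoffel a x i k n) =
    1/2 * (partial k (\<lambda>z. a z $ j $ n) x + partial n (\<lambda>z. a z $ j $ k) x
      - partial j (\<lambda>z. a z $ k $ n) x)"
proof -
  define c where "c l = 1/2 * (partial k (\<lambda>z. a z $ l $ n) x + partial n (\<lambda>z. a z $ l $ k) x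
      - partial l (\<lambda>z. a z $ k $ n) x)" for l
  have chr: "christoffel a x i k n = (\<Sum>l\<in>UNIV. matrix_inv (a x) $ i $ l * c l)" for i
    unfolding christoffel_def c_def sum_distrib_left by (simp add: algebra_simps)
  have "(\<Sum>i\<in>UNIV. a x $ j $ i * christoffel a x i k n)
      = (a x *v (matrix_inv (a x) *v (\<chi> l. c l))) $ j"
    by (simp add: matrix_vector_mult_def chr)
  also have "\<dots> = c j"
    by (simp add: matrix_vector_mul_assoc assms)
  finally show ?thesis unfolding c_def .
qed

lemma metric_symmetry_partial:
  assumes "open U" "riemannian_metric U a" "x \<in> U"
  shows "partial n (\<lambda>z. a z $ j $ k) x = partial n (\<lambda>z. a z $ k $ j) x"
proof -
  \<comment> \<open>Symmetry of the metric is known on \<open>U\<close> only; since \<open>U\<close>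
    is open, this is a neighbourhood of \<open>x\<close> and the derivatives agree.\<close>
  have sym: "a z $ j $ k = a z $ k $ j" if "z \<in> U" for z
    using riemannian_metricD(1)[OF assms(2) that] by (metis transpose_def vec_lambda_beta)
  have "(a has_derivative frechet_derivative a (at x)) (at x)"
    using assms smooth_on_has_derivative unfolding riemannian_metric_def by blast
  then have "((\<lambda>z. a z $ j $ k) has_derivative (\<lambda>v. frechet_derivative a (at x) v $ j $ k)) (at x)"
    by (intro has_derivative_component)
  then have "(\<lambda>z. a z $ j $ k) differentiable at x"
    by (auto simp: differentiable_def)
  then show ?thesis
    unfolding partial_def
    using frechet_derivative_transform_within_open[OF _ assms(1,3) sym] by simp
qed

text \<open>In the sum of the two symbols of the first kind the derivatives in directions
  \<open>j\<close> and \<open>k\<close> cancel, and the average of two equal derivatives in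
  direction \<open>n\<close> remains.\<close>

lemma metric_compatibility:
  assumes "open U" "riemannian_metric U a" "x \<in> U"
  shows "partial n (\<lambda>z. a z $ j $ k) x =
    (\<Sum>i\<in>UNIV. a x $ j $ i * christoffel a x i k n) + (\<Sum>i\<in>UNIV. a x $ k $ i * christoffel a x i j n)"
proof -
  have average: "p = q \<Longrightarrow> p = 1/2 * (r + p - s) + 1/2 * (s + q - r)" for p q r s :: real
    by (simp add: field_simps)
  show ?thesis
    unfolding christoffel_lowered[of a x, OF riemannian_metricD(3)[OF assms(2,3)]]
    by (rule average) (rule metric_symmetry_partial[OF assms])
qed

text \<open>Leibniz rule for the Levi-Civita connection: the derivative of the metric supplies
  exactly the two Christoffel terms. The base point is an arbitrary map \<open>X\<close>, so that
  the rule serves on the bundle of single vectors and on that of pairs; the value of the derivative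
  matters only in a direction \<open>u\<close> lying over \<open>axis n 1\<close>.\<close>

lemma riem_inner_has_derivative:
  fixes a :: "real ^ 'n \<Rightarrow> real ^ 'n ^ 'n"
  assumes "open U" "riemannian_metric U a" "X z \<in> U"
    and X: "(X has_derivative X') (at z)"
    and v: "(v has_derivative v') (at z)" and w: "(w has_derivative w') (at z)"
    and u: "X' u = axis n 1"
  obtains P' where "((\<lambda>z. riem_inner a (X z) (v z) (w z)) has_derivative P') (at z)"
    "P' u = riem_inner a (X z) (v' u + christoffel_matrix a (X z) n *v v z) (w z)
      + riem_inner a (X z) (v z) (w' u + christoffel_matrix a (X z) n *v w z)"
proof
  let ?A = "frechet_derivative a (at (X z))"
  have a: "(a has_derivative ?A) (at (X z))"
    using assms smooth_on_has_derivative unfolding riemannian_metric_def by blast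
  have aX: "((\<lambda>z. a (X z) $ i $ j) has_derivative (\<lambda>u. ?A (X' u) $ i $ j)) (at z)" for i j
    by (intro has_derivative_component has_derivative_compose[OF X a])
  let ?P = "\<lambda>u. \<Sum>i\<in>UNIV. \<Sum>j\<in>UNIV. a (X z) $ i $ j * v z $ i * w' u $ j
     + (a (X z) $ i $ j * v' u $ i + ?A (X' u) $ i $ j * v z $ i) * w z $ j"
  show "((\<lambda>z. riem_inner a (X z) (v z) (w z)) has_derivative ?P) (at z)"
    unfolding riem_inner_def
    by (intro has_derivative_sum has_derivative_mult aX has_derivative_component[OF v]
        has_derivative_component[OF w])
  let ?G = "christoffel_matrix a (X z) n"
  have A: "?A (X' u) = a (X z) ** ?G + transpose (a (X z) ** ?G)"
  proof -
    have "?A (X' u) $ i $ j = partial n (\<lambda>z. a z $ i $ j) (X z)" for i j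
      unfolding u by (rule partial_eq[symmetric]) (intro has_derivative_component a)
    then show ?thesis
      using metric_compatibility[OF assms(1-3)]
      by (simp add: vec_eq_iff matrix_matrix_mult_def transpose_def christoffel_matrix_def)
  qed
  \<comment> \<open>The derivative of the metric is a bilinear form too, written here as
    \<open>riem_inner\<close> of a constant matrix field.\<close>
  have "?P u = riem_inner a (X z) (v z) (w' u) + (riem_inner a (X z) (v' u) (w z)
      + riem_inner (\<lambda>_. ?A (X' u)) (X z) (v z) (w z))"
    unfolding riem_inner_def sum.distrib[symmetric] distrib_right ..
  also have "riem_inner (\<lambda>_. ?A (X' u)) (X z) (v z) (w z)
      = riem_inner a (X z) (?G *v v z) (w z) + riem_inner a (X z) (v z) (?G *v w z)"
    using riem_inner_matrix_sum[of a "X z" ?G] riemannian_metricD(1)[OF assms(2,3)] A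
    by (simp add: riem_inner_eq)
  finally show "?P u = riem_inner a (X z) (v' u + ?G *v v z) (w z)
            + riem_inner a (X z) (v z) (w' u + ?G *v w z)"
    unfolding riem_inner_bilinear by simp
qed

subsection \<open>Conformally automorphic spaces\<close>

text \<open>\<open>h\<close> is the common value of the degree on \<open>U\<close>. With a varying
  degree, differentiating \<open>F x y powr H x\<close> would add a term in the derivative of
  \<open>H\<close>.\<close>

locale conformal_automorphism =
  fixes U :: "(real ^ 'n) set"
    and F :: "real ^ 'n \<Rightarrow> real ^ 'n \<Rightarrow> real"
    and a :: "real ^ 'n \<Rightarrow> real ^ 'n ^ 'n"
    and H :: "real ^ 'n \<Rightarrow> real"
    and t :: "real ^ 'n \<Rightarrow> real ^ 'n \<Rightarrow> real ^ 'n"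
    and h :: real
  assumes open_U: "open U"
    and finsler: "finsler_metric_function U F"
    and metric: "riemannian_metric U a"
    and automorphic: "conformally_automorphic_via U F a H t"
    and degree: "x \<in> U \<Longrightarrow> H x = h"
begin

text \<open>This is the derivative on the total space; its values at \<open>(0, w)\<close> give the
  fibre Jacobian, whose inverse is \<open>dinv\<close>.\<close>

definition dt :: "real ^ 'n \<Rightarrow> real ^ 'n \<Rightarrow> (real ^ 'n) \<times> (real ^ 'n) \<Rightarrow> real ^ 'n" where
  "dt x y = frechet_derivative (\<lambda>(x, y). t x y) (at (x, y))"

definition dinv :: "real ^ 'n \<Rightarrow> real ^ 'n \<Rightarrow> real ^ 'n \<Rightarrow> real ^ 'n" where
  "dinv x y = frechet_derivative (fibre_inv t x) (at (t x y))"

text \<open>The covariant derivative \<open>d\<^sub>n t\<^sup>i + a\<^sup>i\<^sub>k\<^sub>n t\<^sup>k\<close>, where \<open>w\<close> is the \<open>n\<close>-th column of the coefficients.\<close>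

definition cov :: "real ^ 'n \<Rightarrow> real ^ 'n \<Rightarrow> 'n \<Rightarrow> real ^ 'n \<Rightarrow> real ^ 'n" where
  "cov x y n w = dt x y (axis n 1, w) + christoffel_matrix a x n *v t x y"

section \<open>The transformation and its fibrewise inverse\<close>

lemma open_slit_bundle: "open (U \<times> (nonzero :: (real ^ 'n) set))"
  by (intro open_Times open_U open_Compl closed_singleton)

lemma t_has_derivative:
  assumes "x \<in> U" "y \<noteq> 0"
  shows "((\<lambda>(x, y). t x y) has_derivative dt x y) (at (x, y))"
  unfolding dt_def using automorphic assms
  by (intro smooth_on_has_derivative[of "U \<times> nonzero"])
    (auto simp: conformally_automorphic_via_def)

lemma t_bij:
  assumes "x \<in> U"
  shows "bij_betw (t x) nonzero nonzero"
  using automorphic assms by (simp add: conformally_automorphic_via_def)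

lemma t_nonzero:
  assumes "x \<in> U" "y \<noteq> 0"
  shows "t x y \<noteq> 0"
  using bij_betwE[OF t_bij[OF assms(1)]] assms(2) by auto

lemma fibre_inv_t:
  assumes "x \<in> U" "y \<noteq> 0"
  shows "fibre_inv t x (t x y) = y"
  using bij_betw_inv_into_left[OF t_bij[OF assms(1)]] assms(2) by (simp add: fibre_inv_def)

lemma t_fibre_inv:
  assumes "x \<in> U" "s \<noteq> 0"
  shows "fibre_inv t x s \<noteq> 0" "t x (fibre_inv t x s) = s"
  using bij_betw_inv_into_right[OF t_bij[OF assms(1)]] assms(2)
    bij_betwE[OF bij_betw_inv_into[OF t_bij[OF assms(1)]]] by (auto simp: fibre_inv_def)

lemma t_fibre_has_derivative:
  assumes "x \<in> U" "y \<noteq> 0"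
  shows "(t x has_derivative (\<lambda>w. dt x y (0, w))) (at y)"
  using has_derivative_compose[of "\<lambda>z. (x, z)" "\<lambda>u. (0, u)" y UNIV, OF _ t_has_derivative[OF assms]]
  by (simp add: has_derivative_Pair)

lemma fibre_inv_has_derivative:
  assumes "x \<in> U" "y \<noteq> 0"
  shows "(fibre_inv t x has_derivative dinv x y) (at (t x y))"
  unfolding dinv_def using automorphic assms t_nonzero[OF assms]
  by (intro smooth_on_has_derivative[of nonzero]) (auto simp: conformally_automorphic_via_def)

text \<open>The composite is the identity on the open set of nonzero vectors, so the chain rule
  inverts the Jacobian on this side; \<open>dt_dinv\<close> treats the other side.\<close>

lemma dinv_dt:
  assumes "x \<in> U" "y \<noteq> 0"
  shows "dinv x y (dt x y (0, w)) = w"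
proof -
  have "((\<lambda>z. fibre_inv t x (t x z)) has_derivative (\<lambda>w. dinv x y (dt x y (0, w)))) (at y)"
    by (rule has_derivative_compose[OF t_fibre_has_derivative fibre_inv_has_derivative]) (use assms in auto)
  then have "((\<lambda>z. z) has_derivative (\<lambda>w. dinv x y (dt x y (0, w)))) (at y)"
    by (rule has_derivative_transform_within_open[of _ _ _ _ nonzero])
      (use assms fibre_inv_t in \<open>auto intro!: open_Compl\<close>)
  from has_derivative_unique[OF this has_derivative_ident] show ?thesis by metis
qed

lemma dt_dinv:
  assumes "x \<in> U" "y \<noteq> 0"
  shows "dt x y (0, dinv x y s) = s"
proof -
  have "((\<lambda>z. t x (fibre_inv t x z)) has_derivative (\<lambda>w. dt x y (0, dinv x y w))) (at (t x y))"
    using has_derivative_compose[OF fibre_inv_has_derivative[OF assms], of "t x" "\<lambda>w. dt x y (0, w)"]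
      t_fibre_has_derivative[OF assms] fibre_inv_t[OF assms] by simp
  then have "((\<lambda>z. z) has_derivative (\<lambda>w. dt x y (0, dinv x y w))) (at (t x y))"
    by (rule has_derivative_transform_within_open[of _ _ _ _ nonzero])
      (use assms t_nonzero t_fibre_inv in \<open>auto intro!: open_Compl\<close>)
  from has_derivative_unique[OF this has_derivative_ident] show ?thesis by metis
qed

lemma linear_dt: "x \<in> U \<Longrightarrow> y \<noteq> 0 \<Longrightarrow> linear (dt x y)"
  using t_has_derivative has_derivative_linear by blast

lemma linear_dinv: "x \<in> U \<Longrightarrow> y \<noteq> 0 \<Longrightarrow> linear (dinv x y)"
  using fibre_inv_has_derivative has_derivative_linear by blast

lemma dinv_component:
  assumes "x \<in> U" "y \<noteq> 0"
  shows "(\<Sum>i\<in>UNIV. partial i (\<lambda>s. fibre_inv t x s $ m) (t x y) * v $ i) = dinv x y v $ m"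
  using sum_partial[OF has_derivative_component[OF fibre_inv_has_derivative[OF assms]]]
  by (simp add: mult.commute)

lemma solution_coeffs_column:
  assumes "x \<in> U" "y \<noteq> 0"
  shows "column n (solution_coeffs a t x y) = - dinv x y (cov x y n 0)"
proof -
  have "((\<lambda>z. (\<lambda>(x, y). t x y) (z, y)) has_derivative (\<lambda>u. dt x y (u, 0))) (at x)"
    using has_derivative_compose[of "\<lambda>z. (z, y)" "\<lambda>u. (u, 0)" x UNIV, OF _ t_has_derivative[OF assms]]
    by (simp add: has_derivative_Pair)
  then have "partial n (\<lambda>z. t z y $ i) x = dt x y (axis n 1, 0) $ i" for i
    by (intro partial_eq[of _ "\<lambda>u. dt x y (u, 0) $ i"]) (auto intro: has_derivative_component)
  then have "partial n (\<lambda>z. t z y $ i) x + (\<Sum>k\<in>UNIV. christoffel a x i k n * t x y $ k)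
      = cov x y n 0 $ i" for i
    by (simp add: cov_def christoffel_matrix_def matrix_vector_mult_def)
  then show ?thesis
    by (simp add: vec_eq_iff column_def solution_coeffs_def dinv_component[OF assms])
qed

lemma tensor_shift_column:
  assumes "x \<in> U" "y \<noteq> 0"
  shows "column n (tensor_shift t A x y) = dinv x y ((\<chi> i k. A x i k n) *v t x y)"
  using dinv_component[OF assms, where v = "(\<chi> i k. A x i k n) *v t x y"]
  by (simp add: vec_eq_iff column_def tensor_shift_def matrix_vector_mult_def)

text \<open>\<open>cov\<close> is affine in \<open>w\<close> with the invertible fibre Jacobian as
  linear part. Columns of coefficients and values of \<open>cov\<close> therefore determine each
  other, and \<open>solution_coeffs\<close> corresponds to the value zero.\<close>

lemma cov_eq_iff:
  assumes "x \<in> U" "y \<noteq> 0"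
  shows "cov x y n w = v \<longleftrightarrow> w = column n (solution_coeffs a t x y) + dinv x y v"
proof -
  have "cov x y n w = cov x y n 0 + dt x y (0, w)"
    using linear_add[OF linear_dt[OF assms], of "(axis n 1, 0)" "(0, w)"] by (simp add: cov_def)
  then have "cov x y n w = v \<longleftrightarrow> dt x y (0, w) = v - cov x y n 0"
    by (auto simp: algebra_simps)
  also have "\<dots> \<longleftrightarrow> w = dinv x y (v - cov x y n 0)"
    using dt_dinv[OF assms] dinv_dt[OF assms] by metis
  finally show ?thesis
    by (simp add: solution_coeffs_column[OF assms] linear_diff[OF linear_dinv[OF assms]])
qed

section \<open>Homogeneity and the length of transformed vectors\<close>

lemma t_scale:
  assumes "x \<in> U" "y \<noteq> 0" "c > 0"
  shows "t x (c *\<^sub>R y) = (c powr h) *\<^sub>R t x y"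
  using automorphic assms degree by (simp add: conformally_automorphic_via_def)

text \<open>Differentiate the homogeneity relation of \<open>t\<close> on the total space. The
  factor \<open>c powr h\<close> does not depend on the base point, so no extra term
  appears.\<close>

lemma cov_scale:
  assumes "x \<in> U" "y \<noteq> 0" "c > 0"
  shows "cov x (c *\<^sub>R y) n (c *\<^sub>R w) = (c powr h) *\<^sub>R cov x y n w"
proof -
  have "((\<lambda>z. (\<lambda>(x, y). t x y) (fst z, c *\<^sub>R snd z)) has_derivative
      (\<lambda>u. dt x (c *\<^sub>R y) (fst u, c *\<^sub>R snd u))) (at (x, y))"
    by (rule has_derivative_compose[of "\<lambda>z. (fst z, c *\<^sub>R snd z)"])
      (use assms in \<open>auto intro!: derivative_eq_intros t_has_derivative\<close>)
  then have "((\<lambda>(x, y). (c powr h) *\<^sub>R t x y) has_derivative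
      (\<lambda>u. dt x (c *\<^sub>R y) (fst u, c *\<^sub>R snd u))) (at (x, y))"
  proof (rule has_derivative_transform_within_open[OF _ open_slit_bundle])
    fix z assume "z \<in> U \<times> (nonzero :: (real ^ 'n) set)"
    then have "fst z \<in> U" "snd z \<noteq> 0" by auto
    from t_scale[OF this assms(3)]
    show "(case (fst z, c *\<^sub>R snd z) of (x, y) \<Rightarrow> t x y) = (case z of (x, y) \<Rightarrow> (c powr h) *\<^sub>R t x y)"
      by (simp add: case_prod_unfold)
  qed (use assms in auto)
  moreover have "((\<lambda>(x, y). (c powr h) *\<^sub>R t x y) has_derivative (\<lambda>u. (c powr h) *\<^sub>R dt x y u)) (at (x, y))"
    using has_derivative_scaleR_right[OF t_has_derivative[OF assms(1,2)], of "c powr h"]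
    by (simp add: case_prod_unfold)
  ultimately have "(\<lambda>u. dt x (c *\<^sub>R y) (fst u, c *\<^sub>R snd u)) = (\<lambda>u. (c powr h) *\<^sub>R dt x y u)"
    by (rule has_derivative_unique)
  from fun_cong[OF this, of "(axis n 1, w)"] show ?thesis
    by (simp add: cov_def t_scale[OF assms] scaleR_right_distrib matrix_vector_mult_scaleR)
qed

lemma F_pos:
  assumes "x \<in> U" "y \<noteq> 0"
  shows "F x y > 0"
  using finsler assms by (simp add: finsler_metric_function_def)

lemma riem_function_t:
  assumes "x \<in> U" "y \<noteq> 0"
  shows "riem_function a x (t x y) = F x y powr h"
proof -
  \<comment> \<open>\<open>u\<close> lies on the indicatrix, where both lengths are 1; the general
    case follows by scaling back.\<close>
  define u where "u = (1 / F x y) *\<^sub>R y"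
  have F: "F x y > 0" using F_pos[OF assms] .
  have u: "u \<noteq> 0" "y = F x y *\<^sub>R u" using F assms by (auto simp: u_def)
  have "F x (k *\<^sub>R y) = k * F x y" if "k > 0" for k
    using finsler assms that by (simp add: finsler_metric_function_def)
  then have "F x u = 1" using F by (simp add: u_def)
  then have "riem_function a x (t x u) = 1"
    using automorphic assms u by (simp add: conformally_automorphic_via_def)
  moreover have "t x y = (F x y powr h) *\<^sub>R t x u"
    using t_scale[OF assms(1) u(1) F] u(2) by simp
  ultimately show ?thesis
    by (simp add: riem_function_def riem_inner_bilinear real_sqrt_mult)
qed

lemma F_has_derivative:
  assumes "x \<in> U" "y \<noteq> 0"
  obtains F' where "((\<lambda>(x, y). F x y) has_derivative F') (at (x, y))"
proof -
  have "Ck_on (Suc (Suc 0)) (U \<times> nonzero) (\<lambda>(x, y). F x y)"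
    using finsler by (simp add: finsler_metric_function_def numeral_2_eq_2)
  then have "(\<lambda>(x, y). F x y) differentiable (at (x, y))"
    using assms by auto
  then show ?thesis using that by (auto simp: differentiable_def)
qed

section \<open>Derivatives of lengths and scalar products of transformed vectors\<close>

lemma t_compose_has_derivative:
  assumes X: "(X has_derivative X') (at z)" and Y: "(Y has_derivative Y') (at z)"
    and "X z \<in> U" "Y z \<noteq> 0"
  shows "((\<lambda>z. t (X z) (Y z)) has_derivative (\<lambda>u. dt (X z) (Y z) (X' u, Y' u))) (at z)"
  using has_derivative_compose[OF has_derivative_Pair[OF X Y], of "\<lambda>(x, y). t x y"]
    t_has_derivative[OF assms(3,4)] by simp

lemma inner_t_has_derivative:
  assumes X: "(X has_derivative X') (at z)" "X z \<in> U"
    and Y: "(Y has_derivative Y') (at z)" "Y z \<noteq> 0"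
    and Z: "(Z has_derivative Z') (at z)" "Z z \<noteq> 0"
    and u: "X' u = axis n 1"
  obtains P' where
    "((\<lambda>z. riem_inner a (X z) (t (X z) (Y z)) (t (X z) (Z z))) has_derivative P') (at z)"
    "P' u = riem_inner a (X z) (cov (X z) (Y z) n (Y' u)) (t (X z) (Z z))
            + riem_inner a (X z) (t (X z) (Y z)) (cov (X z) (Z z) n (Z' u))"
proof (rule riem_inner_has_derivative[where X = X and X' = X' and z = z and u = u and n = n
      and v = "\<lambda>z. t (X z) (Y z)" and w = "\<lambda>z. t (X z) (Z z)", OF open_U metric X(2,1)])
  show "((\<lambda>z. t (X z) (Y z)) has_derivative (\<lambda>u. dt (X z) (Y z) (X' u, Y' u))) (at z)"
    "((\<lambda>z. t (X z) (Z z)) has_derivative (\<lambda>u. dt (X z) (Z z) (X' u, Z' u))) (at z)"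
    by (intro t_compose_has_derivative X Y Z)+
  show "X' u = axis n 1" by (rule u)
qed (rule that, assumption, simp only: u cov_def)

lemma norm_t_has_derivative:
  assumes X: "(X has_derivative X') (at z)" "X z \<in> U"
    and Y: "(Y has_derivative Y') (at z)" "Y z \<noteq> 0"
    and u: "X' u = axis n 1"
  obtains R' where
    "((\<lambda>z. riem_function a (X z) (t (X z) (Y z))) has_derivative R') (at z)"
    "R' u * riem_function a (X z) (t (X z) (Y z)) = riem_inner a (X z) (cov (X z) (Y z) n (Y' u)) (t (X z) (Y z))"
proof -
  let ?P = "riem_inner a (X z) (t (X z) (Y z)) (t (X z) (Y z))"
  obtain P' where P: "((\<lambda>z. riem_inner a (X z) (t (X z) (Y z)) (t (X z) (Y z))) has_derivative P') (at z)"
    and P': "P' u = riem_inner a (X z) (cov (X z) (Y z) n (Y' u)) (t (X z) (Y z))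
            + riem_inner a (X z) (t (X z) (Y z)) (cov (X z) (Y z) n (Y' u))"
    by (rule inner_t_has_derivative[where X = X and Y = Y and Z = Y and z = z, OF X Y Y u])
  have pos: "?P > 0"
    using metric X(2) by (rule riemannian_metricD(2)) (intro t_nonzero X Y)
  show thesis
  proof
    show "((\<lambda>z. riem_function a (X z) (t (X z) (Y z))) has_derivative
        (\<lambda>u. P' u * (inverse (sqrt ?P) / 2))) (at z)"
      unfolding riem_function_def using pos P by (rule has_derivative_real_sqrt)
    show "P' u * (inverse (sqrt ?P) / 2) * riem_function a (X z) (t (X z) (Y z))
        = riem_inner a (X z) (cov (X z) (Y z) n (Y' u)) (t (X z) (Y z))"
      using P' pos riem_inner_commute[of a "X z" "t (X z) (Y z)" "cov (X z) (Y z) n (Y' u)"]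
        riemannian_metricD(1)[OF metric X(2)]
      by (simp add: riem_function_def)
  qed
qed

text \<open>Differentiating \<open>riem_function_t\<close> gives the derivative of the length as
  \<open>h * F x y powr (h - 1)\<close> times that of \<open>F\<close>, a nonzero factor. By
  \<open>norm_t_has_derivative\<close> the same derivative times the positive length is the scalar
  product of \<open>cov\<close> with \<open>t x y\<close>.\<close>

lemma covariant_radial:
  assumes "x \<in> U" "y \<noteq> 0"
  shows "partial n (\<lambda>z. F z y) x + (\<Sum>k\<in>UNIV. w $ k * partial k (F x) y) = 0
    \<longleftrightarrow> riem_inner a x (cov x y n w) (t x y) = 0"
proof -
  obtain F' where F': "((\<lambda>(x, y). F x y) has_derivative F') (at (x, y))"
    using F_has_derivative[OF assms] .
  have pos: "F x y > 0" "h > 0"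
    using F_pos[OF assms] automorphic degree assms
    by (auto simp: conformally_automorphic_via_def)
  obtain R' where R: "((\<lambda>z. riem_function a (fst z) (t (fst z) (snd z))) has_derivative R') (at (x, y))"
    and R': "R' (axis n 1, w) * riem_function a x (t x y) = riem_inner a x (cov x y n w) (t x y)"
    using norm_t_has_derivative[OF has_derivative_fst[OF has_derivative_ident] _
      has_derivative_snd[OF has_derivative_ident], of "(x, y)" "(axis n 1, w)" n] assms
    by auto
  have "((\<lambda>z. F (fst z) (snd z) powr h) has_derivative
      (\<lambda>u. h * F x y powr (h - 1) * F' u)) (at (x, y))"
    using has_derivative_compose[OF F', of "\<lambda>r. r powr h" "\<lambda>u. h * F x y powr (h - 1) * u"] pos(1)
      has_real_derivative_powr[of "F x y" h]
    by (simp add: case_prod_unfold has_field_derivative_def)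
  then have "((\<lambda>z. riem_function a (fst z) (t (fst z) (snd z))) has_derivative
      (\<lambda>u. h * F x y powr (h - 1) * F' u)) (at (x, y))"
  proof (rule has_derivative_transform_within_open[OF _ open_slit_bundle])
    fix z assume "z \<in> U \<times> (nonzero :: (real ^ 'n) set)"
    then have "fst z \<in> U" "snd z \<noteq> 0" by auto
    then show "F (fst z) (snd z) powr h = riem_function a (fst z) (t (fst z) (snd z))"
      by (rule riem_function_t[symmetric])
  qed (use assms in auto)
  from has_derivative_unique[OF this R] have "R' (axis n 1, w) = h * F x y powr (h - 1) * F' (axis n 1, w)"
    by metis
  moreover have "riem_function a x (t x y) > 0"
    using riem_function_t[OF assms] pos by simp
  ultimately have "F' (axis n 1, w) = 0 \<longleftrightarrow> riem_inner a x (cov x y n w) (t x y) = 0"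
    using R' pos by auto
  then show ?thesis
    using total_partial_two[OF F', of n w] by simp
qed

text \<open>Orthogonality makes both lengths stationary in the direction considered, so the quotient
  rule leaves only the derivative of the numerator over a nonzero denominator.\<close>

lemma covariant_two_vector_scalar:
  assumes x: "x \<in> U" and y: "y1 \<noteq> 0" "y2 \<noteq> 0"
    and radial: "riem_inner a x (cov x y1 n w1) (t x y1) = 0" "riem_inner a x (cov x y2 n w2) (t x y2) = 0"
  shows "partial n (\<lambda>z. two_vector_scalar a t z y1 y2) x
      + (\<Sum>k\<in>UNIV. w1 $ k * partial k (\<lambda>w. two_vector_scalar a t x w y2) y1)
      + (\<Sum>k\<in>UNIV. w2 $ k * partial k (two_vector_scalar a t x y1) y2) = 0
    \<longleftrightarrow> riem_inner a x (cov x y1 n w1) (t x y2) + riem_inner a x (t x y1) (cov x y2 n w2) = 0"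
proof -
  let ?p = "(x, y1, y2)" and ?u = "(axis n 1, w1, w2)"
  have u: "fst ?u = axis n 1" by simp
  have X: "(fst has_derivative fst) (at ?p)" "fst ?p \<in> U"
    and Y1: "((\<lambda>z. fst (snd z)) has_derivative (\<lambda>u. fst (snd u))) (at ?p)" "fst (snd ?p) \<noteq> 0"
    and Y2: "((\<lambda>z. snd (snd z)) has_derivative (\<lambda>u. snd (snd u))) (at ?p)" "snd (snd ?p) \<noteq> 0"
    using x y by (auto intro!: derivative_eq_intros)
  define R1 R2 where "R1 = riem_function a x (t x y1)" and "R2 = riem_function a x (t x y2)"
  have R: "R1 \<noteq> 0" "R2 \<noteq> 0"
    using F_pos[OF x y(1)] F_pos[OF x y(2)]
    by (simp_all add: R1_def R2_def riem_function_t[OF x y(1)] riem_function_t[OF x y(2)])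
  obtain P' where P: "((\<lambda>z. riem_inner a (fst z) (t (fst z) (fst (snd z))) (t (fst z) (snd (snd z)))) has_derivative P') (at ?p)"
    and P': "P' ?u = riem_inner a x (cov x y1 n w1) (t x y2) + riem_inner a x (t x y1) (cov x y2 n w2)"
    using inner_t_has_derivative[OF X Y1 Y2 u] by auto
  obtain S1 where S1: "((\<lambda>z. riem_function a (fst z) (t (fst z) (fst (snd z)))) has_derivative S1) (at ?p)"
    and S1': "S1 ?u * R1 = riem_inner a x (cov x y1 n w1) (t x y1)"
    using norm_t_has_derivative[OF X Y1 u] unfolding R1_def by auto
  obtain S2 where S2: "((\<lambda>z. riem_function a (fst z) (t (fst z) (snd (snd z)))) has_derivative S2) (at ?p)"
    and S2': "S2 ?u * R2 = riem_inner a x (cov x y2 n w2) (t x y2)"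
    using norm_t_has_derivative[OF X Y2 u] unfolding R2_def by auto
  have S_zero: "S1 ?u = 0" "S2 ?u = 0" using S1' S2' R radial by auto
  obtain L' where L: "((\<lambda>(x, y1, y2). two_vector_scalar a t x y1 y2) has_derivative L') (at ?p)"
    and L': "L' ?u = P' ?u / (R1 * R2)"
  proof
    let ?n = "riem_inner a x (t x y1) (t x y2)"
    show "((\<lambda>(x, y1, y2). two_vector_scalar a t x y1 y2) has_derivative
        (\<lambda>u. (P' u * (R1 * R2) - ?n * (R1 * S2 u + S1 u * R2)) / ((R1 * R2) * (R1 * R2)))) (at ?p)"
      using has_derivative_divide'[OF P has_derivative_mult[OF S1 S2]] R
      by (simp add: case_prod_unfold two_vector_scalar_def R1_def R2_def)
    show "(P' ?u * (R1 * R2) - ?n * (R1 * S2 ?u + S1 ?u * R2)) / ((R1 * R2) * (R1 * R2)) = P' ?u / (R1 * R2)"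
      using R by (simp add: S_zero)
  qed
  show ?thesis
    unfolding total_partial_three[OF L] L' P' using R by simp
qed

section \<open>The two equations in terms of the covariant derivative\<close>

lemma d_vanishes_iff:
  "d_vanishes U N F \<longleftrightarrow>
    (\<forall>x\<in>U. \<forall>y\<in>nonzero. \<forall>n. riem_inner a x (cov x y n (column n (N x y))) (t x y) = 0)"
  using covariant_radial[of _ _ _ "column _ (N _ _)"] by (simp add: d_vanishes_def column_def)

lemma d_vanishes2_iff:
  assumes "d_vanishes U N F"
  shows "d_vanishes2 U N (two_vector_scalar a t) \<longleftrightarrow>
    (\<forall>x\<in>U. \<forall>y1\<in>nonzero. \<forall>y2\<in>nonzero. \<forall>n.
      riem_inner a x (cov x y1 n (column n (N x y1))) (t x y2)
      + riem_inner a x (t x y1) (cov x y2 n (column n (N x y2))) = 0)"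
proof -
  have "partial n (\<lambda>z. two_vector_scalar a t z y1 y2) x
      + (\<Sum>k\<in>UNIV. N x y1 $ k $ n * partial k (\<lambda>w. two_vector_scalar a t x w y2) y1)
      + (\<Sum>k\<in>UNIV. N x y2 $ k $ n * partial k (two_vector_scalar a t x y1) y2) = 0 \<longleftrightarrow>
      riem_inner a x (cov x y1 n (column n (N x y1))) (t x y2)
      + riem_inner a x (t x y1) (cov x y2 n (column n (N x y2))) = 0"
    if "x \<in> U" "y1 \<noteq> 0" "y2 \<noteq> 0" for x y1 y2 n
    using covariant_two_vector_scalar[of x y1 y2 n "column n (N x y1)" "column n (N x y2)"]
      assms that unfolding d_vanishes_iff by (simp add: column_def)
  then show ?thesis unfolding d_vanishes2_def by simp
qed

lemma cov_solution_coeffs: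
  assumes "x \<in> U" "y \<noteq> 0"
  shows "cov x y n (column n (solution_coeffs a t x y)) = 0"
  by (simp add: cov_eq_iff[OF assms] linear_0[OF linear_dinv[OF assms]])

lemma homogeneous_solution_coeffs: "homogeneous_coeffs U (solution_coeffs a t)"
  unfolding homogeneous_coeffs_def
proof (intro ballI allI impI)
  fix x y :: "real ^ 'n" and c :: real
  assume x: "x \<in> U" and "y \<in> nonzero" and c: "c > 0"
  then have y: "y \<noteq> 0" "c *\<^sub>R y \<noteq> 0" by auto
  have "column n (solution_coeffs a t x (c *\<^sub>R y)) = c *\<^sub>R column n (solution_coeffs a t x y)" for n
  proof -
    \<comment> \<open>By \<open>cov_scale\<close> the scaled column annihilates \<open>cov\<close>
      at the scaled vector; \<open>cov_eq_iff\<close> says that only one column does.\<close>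
    have "cov x (c *\<^sub>R y) n (c *\<^sub>R column n (solution_coeffs a t x y)) = 0"
      using cov_scale[OF x y(1) c] cov_solution_coeffs[OF x y(1)] by simp
    then show ?thesis
      unfolding cov_eq_iff[OF x y(2)] by (simp add: linear_0[OF linear_dinv[OF x y(2)]])
  qed
  then show "solution_coeffs a t x (c *\<^sub>R y) = c *\<^sub>R solution_coeffs a t x y"
    by (simp add: vec_eq_iff column_def)
qed

lemma coeffs_eq_iff:
  assumes "x \<in> U" "y \<noteq> 0"
  shows "N x y = solution_coeffs a t x y + tensor_shift t A x y \<longleftrightarrow>
    (\<forall>n. cov x y n (column n (N x y)) = (\<chi> i k. A x i k n) *v t x y)"
  unfolding cov_eq_iff[OF assms] tensor_shift_column[OF assms, symmetric]
  by (auto simp: vec_eq_iff column_def)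

section \<open>Skew tensors and skew operators\<close>

lemma skew_tensor_matrix:
  assumes "skew_tensor U a A" "x \<in> U"
  shows "riem_inner a x ((\<chi> i k. A x i k n) *v v) w + riem_inner a x v ((\<chi> i k. A x i k n) *v w) = 0"
proof -
  have "a x ** (\<chi> i k. A x i k n) + transpose (a x ** (\<chi> i k. A x i k n)) = 0"
    using assms by (simp add: skew_tensor_def vec_eq_iff matrix_matrix_mult_def transpose_def)
  then show ?thesis
    using riem_inner_matrix_sum[of a x "\<chi> i k. A x i k n"] riemannian_metricD(1)[OF metric assms(2)]
    by simp
qed

text \<open>Skewness moves \<open>b\<close> to the basis vectors, so \<open>\<langle>b v, e\<^sub>j\<rangle>\<close> is linear in \<open>v\<close>; nondegeneracy does the rest.\<close>

lemma skew_operator_linear: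
  assumes x: "x \<in> U"
    and skew: "\<And>v w. v \<noteq> 0 \<Longrightarrow> w \<noteq> 0 \<Longrightarrow> riem_inner a x (b v) w + riem_inner a x v (b w) = 0"
    and v: "v \<noteq> 0"
  shows "b v = (\<chi> i k. b (axis k 1) $ i) *v v"
proof -
  let ?B = "\<chi> i k. b (axis k 1) $ i"
  have axis: "axis k 1 \<noteq> (0 :: real ^ 'n)" for k by (simp add: axis_eq_0_iff)
  have lin: "linear (\<lambda>u. riem_inner a x u w)" for w
    by (rule linearI) (simp_all add: riem_inner_bilinear)
  have expand: "riem_inner a x u w = (\<Sum>k\<in>UNIV. u $ k * riem_inner a x (axis k 1) w)" for u w
  proof -
    have "riem_inner a x (\<Sum>k\<in>UNIV. u $ k *\<^sub>R axis k 1) w = (\<Sum>k\<in>UNIV. u $ k * riem_inner a x (axis k 1) w)"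
      by (simp add: linear_sum[OF lin] riem_inner_bilinear)
    then show ?thesis by (simp add: basis_expansion flip: scalar_mult_eq_scaleR)
  qed
  have Bv: "?B *v v = (\<Sum>k\<in>UNIV. v $ k *\<^sub>R b (axis k 1))"
    by (simp add: vec_eq_iff matrix_vector_mult_def mult.commute)
  have comm: "riem_inner a x u w = riem_inner a x w u" for u w
    using riem_inner_commute riemannian_metricD(1)[OF metric x] by metis
  have agree: "riem_inner a x (axis j 1) (b v) = riem_inner a x (axis j 1) (?B *v v)" for j
  proof -
    have "riem_inner a x (b v) (axis j 1) = - riem_inner a x v (b (axis j 1))"
      using skew[OF v axis, of j] by linarith
    also have "\<dots> = (\<Sum>k\<in>UNIV. v $ k * - riem_inner a x (axis k 1) (b (axis j 1)))"
      by (subst expand) (simp add: sum_negf)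
    also have "\<dots> = (\<Sum>k\<in>UNIV. v $ k * riem_inner a x (b (axis k 1)) (axis j 1))"
    proof -
      \<comment> \<open>A second use of skewness, now on two basis vectors, moves \<open>b\<close>
        back so that the sum becomes the matrix applied to \<open>v\<close>.\<close>
      have "- riem_inner a x (axis k 1) (b (axis j 1)) = riem_inner a x (b (axis k 1)) (axis j 1)" for k
        using skew[OF axis axis, of k j] by linarith
      then show ?thesis by simp
    qed
    also have "\<dots> = riem_inner a x (?B *v v) (axis j 1)"
      unfolding Bv by (simp add: linear_sum[OF lin] riem_inner_bilinear)
    finally show ?thesis by (simp only: comm)
  qed
  \<comment> \<open>The difference is orthogonal to every basis vector, hence to itself, and
    positive definiteness makes it zero.\<close>
  let ?d = "b v - ?B *v v"
  have "riem_inner a x (axis j 1) ?d = 0" for j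
    using agree[of j] riem_inner_bilinear(2)[of a x "axis j 1" "b v" "- (?B *v v)"]
    by (simp add: riem_inner_bilinear)
  then have "riem_inner a x ?d ?d = 0"
    by (subst expand) simp
  then show ?thesis
    using riemannian_metricD(2)[OF metric x, of ?d] by force
qed

lemma d_vanishes2_skew_tensor:
  assumes N: "d_vanishes U N F" "d_vanishes2 U N (two_vector_scalar a t)"
  obtains A where "skew_tensor U a A"
    "\<And>x y. x \<in> U \<Longrightarrow> y \<noteq> 0 \<Longrightarrow> N x y = solution_coeffs a t x y + tensor_shift t A x y"
proof
  \<comment> \<open>The covariant derivative as a function of \<open>s = t x y\<close>. Because
    \<open>t x\<close> is a bijection, the two-vector equation becomes skewness of
    \<open>b x n\<close> on all pairs of nonzero vectors.\<close>
  define b where "b x n s = cov x (fibre_inv t x s) n (column n (N x (fibre_inv t x s)))" for x n s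
  \<comment> \<open>The matrix entries that \<open>skew_operator_linear\<close> assigns to
    \<open>b x n\<close>.\<close>
  define A where "A x i k n = b x n (axis k 1) $ i" for x i k n
  have axis: "axis k 1 \<noteq> (0 :: real ^ 'n)" for k by (simp add: axis_eq_0_iff)
  have skew: "riem_inner a x (b x n v) w + riem_inner a x v (b x n w) = 0"
    if x: "x \<in> U" and "v \<noteq> 0" "w \<noteq> 0" for x n v w
    using N(2) x t_fibre_inv[OF x that(2)] t_fibre_inv[OF x that(3)]
    unfolding d_vanishes2_iff[OF N(1)] b_def by (metis ComplI singletonD)
  show "skew_tensor U a A"
    unfolding skew_tensor_def
  proof (intro ballI allI)
    fix x j k n assume x: "x \<in> U"
    have "riem_inner a x (axis j 1) v = (\<Sum>i\<in>UNIV. a x $ j $ i * v $ i)" for v j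
      by (simp add: riem_inner_eq inner_axis' matrix_vector_mult_def)
    moreover have "riem_inner a x v (axis j 1) = riem_inner a x (axis j 1) v" for v j
      using riem_inner_commute riemannian_metricD(1)[OF metric x] by metis
    ultimately show "(\<Sum>i\<in>UNIV. a x $ j $ i * A x i k n) + (\<Sum>i\<in>UNIV. a x $ k $ i * A x i j n) = 0"
      using skew[OF x axis axis, of n k j] by (simp add: A_def)
  qed
  fix x y :: "real ^ 'n" assume x: "x \<in> U" and y: "y \<noteq> 0"
  have "cov x y n (column n (N x y)) = b x n (t x y)" for n
    by (simp add: b_def fibre_inv_t[OF x y])
  then show "N x y = solution_coeffs a t x y + tensor_shift t A x y"
    unfolding coeffs_eq_iff[OF x y] A_def
    using skew_operator_linear[OF x skew[OF x] t_nonzero[OF x y]] by simp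
qed

end

theorem proposition2p2:
  fixes U :: "(real ^ 'n) set"
    and F :: "real ^ 'n \<Rightarrow> real ^ 'n \<Rightarrow> real"
    and a :: "real ^ 'n \<Rightarrow> real ^ 'n ^ 'n"
    and H :: "real ^ 'n \<Rightarrow> real"
    and t :: "real ^ 'n \<Rightarrow> real ^ 'n \<Rightarrow> real ^ 'n"
  assumes "CARD('n) \<ge> 3"
    and "open U"
    and "finsler_metric_function U F"
    and "riemannian_metric U a"
    and "conformally_automorphic_via U F a H t"
    and "H constant_on U"
  shows "homogeneous_coeffs U (solution_coeffs a t)
       \<and> d_vanishes U (solution_coeffs a t) F
       \<and> d_vanishes2 U (solution_coeffs a t) (two_vector_scalar a t)
       \<and> (\<forall>N. homogeneous_coeffs U N \<longrightarrow> d_vanishes U N F \<longrightarrow>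
            (d_vanishes2 U N (two_vector_scalar a t) \<longleftrightarrow>
             (\<exists>A. skew_tensor U a A \<and>
                (\<forall>x\<in>U. \<forall>y\<in>nonzero. N x y = solution_coeffs a t x y + tensor_shift t A x y))))"
proof -
  obtain h where "\<And>x. x \<in> U \<Longrightarrow> H x = h"
    using assms(6) unfolding constant_on_def by blast
  then interpret conformal_automorphism U F a H t h
    using assms by unfold_locales auto
  \<comment> \<open>For these coefficients \<open>cov\<close> vanishes identically, so both
    equations reduce to \<open>0 = 0\<close>.\<close>
  have sol: "d_vanishes U (solution_coeffs a t) F"
    unfolding d_vanishes_iff by (simp add: cov_solution_coeffs riem_inner_bilinear)
  moreover have "d_vanishes2 U (solution_coeffs a t) (two_vector_scalar a t)"
    unfolding d_vanishes2_iff[OF sol] by (simp add: cov_solution_coeffs riem_inner_bilinear)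
  moreover have "d_vanishes2 U N (two_vector_scalar a t) \<longleftrightarrow>
      (\<exists>A. skew_tensor U a A \<and>
        (\<forall>x\<in>U. \<forall>y\<in>nonzero. N x y = solution_coeffs a t x y + tensor_shift t A x y))"
    (is "?L \<longleftrightarrow> ?R") if N: "d_vanishes U N F" for N
  proof
    assume ?L
    then obtain A where "skew_tensor U a A"
      "\<And>x y. x \<in> U \<Longrightarrow> y \<noteq> 0 \<Longrightarrow> N x y = solution_coeffs a t x y + tensor_shift t A x y"
      using d_vanishes2_skew_tensor[OF N] by blast
    then show ?R by auto
  next
    assume ?R
    then obtain A where A: "skew_tensor U a A"
      and "\<forall>x\<in>U. \<forall>y\<in>nonzero. N x y = solution_coeffs a t x y + tensor_shift t A x y" by blast
    \<comment> \<open>Shifting the coefficients by \<open>A\<close> makes \<open>cov\<close> equal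
      to \<open>A\<close> applied to \<open>t x y\<close>, and skewness of \<open>A\<close> is then
      the two-vector equation.\<close>
    then have "cov x y n (column n (N x y)) = (\<chi> i k. A x i k n) *v t x y"
      if "x \<in> U" "y \<noteq> 0" for x y n
      using coeffs_eq_iff[OF that, of N A] that by simp
    then show ?L
      unfolding d_vanishes2_iff[OF N] using skew_tensor_matrix[OF A] by simp
  qed
  ultimately show ?thesis using homogeneous_solution_coeffs by blast
qed

end
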